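(* Let $(X,\|\cdot\|)$ be a real normed linear space. Then the following statements are mutually equivalent: (i) $n_{x,y}(t)\leq n_{y,x}(t)$ for all $x,y\in X$ with $\|x\|\leq\|y\|$ and all $t\in[0,1]$. (ii) $\alpha[x,y]\leq\beta[x,y]$ for all nonzero vectors $x,y\in X$. (iii) $(X,\|\cdot\|)$ is an inner product space.
   Context: For $x,y$ in a real normed linear space $X$, the mapping $n_{x,y}:\mathbb{R}\to\mathbb{R}$ is defined by $n_{x,y}(t)=\|x+ty\|$; accordingly $n_{y,x}(t)=\|y+tx\|$. For nonzero $x,y\in X$, the angular distance is $\alpha[x,y]=\left\|\frac{x}{\|x\|}-\frac{y}{\|y\|}\right\|$ and the skew-angular distance is $\beta[x,y]=\left\|\frac{x}{\|y\|}-\frac{y}{\|x\|}\right\|$. Saying that $(X,\|\cdot\|)$ is an inner product space means that the norm is induced by an inner product on $X$, i.e. there is an inner product $\langle\cdot,\cdot\rangle$ on $X$ with $\|x\|^2=\langle x,x\rangle$ for all $x\in X$. *)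

theory Defs
  imports "HOL-Analysis.Analysis"
begin

definition n_map :: "'a::real_normed_vector \<Rightarrow> 'a \<Rightarrow> real \<Rightarrow> real" where
  "n_map x y t = norm (x + t *\<^sub>R y)"

text \<open>The two distances below are meaningful only for nonzero \<open>x\<close> and \<open>y\<close>.\<close>

definition angular_dist :: "'a::real_normed_vector \<Rightarrow> 'a \<Rightarrow> real" where
  "angular_dist x y = norm (x /\<^sub>R norm x - y /\<^sub>R norm y)"

definition skew_angular_dist :: "'a::real_normed_vector \<Rightarrow> 'a \<Rightarrow> real" where
  "skew_angular_dist x y = norm (x /\<^sub>R norm y - y /\<^sub>R norm x)"

text \<open>The algebraic axioms of the type class \<open>real_inner\<close>, as a predicate on a
  binary function, so that the existence of an inner product can be asserted within a formula.\<close>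

definition is_inner_product :: "('a::real_vector \<Rightarrow> 'a \<Rightarrow> real) \<Rightarrow> bool" where
  "is_inner_product ip \<longleftrightarrow>
     (\<forall>x y. ip x y = ip y x) \<and>
     (\<forall>x y z. ip (x + y) z = ip x z + ip y z) \<and>
     (\<forall>r x y. ip (r *\<^sub>R x) y = r * ip x y) \<and>
     (\<forall>x. 0 \<le> ip x x) \<and>
     (\<forall>x. ip x x = 0 \<longleftrightarrow> x = 0)"

definition inner_product_space :: "'a::real_normed_vector itself \<Rightarrow> bool" where
  "inner_product_space _ \<longleftrightarrow>
     (\<exists>ip :: 'a \<Rightarrow> 'a \<Rightarrow> real. is_inner_product ip \<and> (\<forall>x. (norm x)\<^sup>2 = ip x x))"

end

theory Submission
  imports Defs
begin

text \<open>
  Statement (ii) is Lorch's inequality \<open>\<parallel>u + v\<parallel> \<le> \<parallel>r u + v / r\<parallel>\<close> for unit vectors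
  \<open>u\<close>, \<open>v\<close> and \<open>r > 0\<close>.  Its first-order form at \<open>r = 1\<close> says that \<open>\<parallel>x + y\<parallel> = \<parallel>x - y\<parallel>\<close>
  implies \<open>x \<bottom> y\<close> in the sense of Birkhoff.  This forces strict convexity, so that in a plane only
  one direction is orthogonal to a given \<open>y\<close>.  Hence the midpoints of parallel chords of the unit
  circle are collinear, and the reflection exchanging two unit vectors is isometric (Ficken's
  condition).  Writing a unit vector \<open>w = a e\<^sub>1 + b e\<^sub>2\<close> in an orthonormal basis and applying the
  reflection exchanging \<open>e\<^sub>1\<close> and \<open>w\<close> to \<open>e\<^sub>2\<close> gives \<open>a\<^sup>2 + b\<^sup>2 = 1\<close>, so every plane is Euclidean.
\<close>

section \<open>Birkhoff orthogonality and cones on which the norm is additive\<close>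

definition birkhoff_orthogonal :: "'a::real_normed_vector \<Rightarrow> 'a \<Rightarrow> bool" where
  "birkhoff_orthogonal x y \<longleftrightarrow> (\<forall>t. norm x \<le> norm (x + t *\<^sub>R y))"

text \<open>A large multiple of the convex combination splits into \<open>a u + b v\<close> and a
  nonnegative combination of \<open>u\<close> and \<open>v\<close>. The triangle inequality bounds
  the norm of the latter by its coefficient sum, which leaves at least \<open>a + b\<close> for the
  former.\<close>

lemma norm_cone_eq_sum:
  fixes u v :: "'a::real_normed_vector"
  assumes u: "norm u \<le> 1" and v: "norm v \<le> 1" and l: "0 < l" "l < 1"
    and n: "1 \<le> norm ((1 - l) *\<^sub>R u + l *\<^sub>R v)" and ab: "0 \<le> a" "0 \<le> b"
  shows "norm (a *\<^sub>R u + b *\<^sub>R v) = a + b"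
proof (rule antisym)
  have "norm (a *\<^sub>R u + b *\<^sub>R v) \<le> a * norm u + b * norm v"
    using ab by (intro order_trans[OF norm_triangle_ineq]) simp
  also have "\<dots> \<le> a + b"
    using ab u v by (intro add_mono mult_left_le) auto
  finally show "norm (a *\<^sub>R u + b *\<^sub>R v) \<le> a + b" .
next
  \<comment> \<open>The least factor for which both coefficients of the remainder are
    nonnegative.\<close>
  define k where "k = max (a / (1 - l)) (b / l)"
  have k: "a \<le> k * (1 - l)" "b \<le> k * l" "0 \<le> k"
    using l ab by (auto simp: k_def max_def field_simps)
  have "k \<le> norm (k *\<^sub>R ((1 - l) *\<^sub>R u + l *\<^sub>R v))"
    using k n by (simp add: mult_le_cancel_left1)
  also have "k *\<^sub>R ((1 - l) *\<^sub>R u + l *\<^sub>R v) =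
      (a *\<^sub>R u + b *\<^sub>R v) + ((k * (1 - l) - a) *\<^sub>R u + (k * l - b) *\<^sub>R v)"
    by (simp add: algebra_simps)
  also have "norm \<dots> \<le> norm (a *\<^sub>R u + b *\<^sub>R v)
      + (norm ((k * (1 - l) - a) *\<^sub>R u) + norm ((k * l - b) *\<^sub>R v))"
    by (meson add_left_mono norm_triangle_ineq order_trans)
  also have "\<dots> \<le> norm (a *\<^sub>R u + b *\<^sub>R v) + ((k * (1 - l) - a) + (k * l - b))"
    using k u v by (intro add_mono order_refl) (auto intro: mult_left_le)
  finally show "a + b \<le> norm (a *\<^sub>R u + b *\<^sub>R v)"
    by (simp add: algebra_simps)
qed

section \<open>Lorch's inequality, orthogonality and strict convexity\<close>

locale lorch_norm =
  fixes space_type :: "'a::real_normed_vector itself"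
  assumes lorch: "\<And>u v :: 'a. norm u = 1 \<Longrightarrow> norm v = 1 \<Longrightarrow> 0 < r \<Longrightarrow>
    norm (u + v) \<le> norm (r *\<^sub>R u + v /\<^sub>R r)"
begin

text \<open>With \<open>r = 1 + h\<close> one has \<open>r u + v / r = (u + v) + h (u - v) + h\<^sup>2 / (1 + h) v\<close>; by convexity
  a descent of the norm along \<open>u - v\<close> would be of first order in \<open>h\<close>.\<close>

lemma unit_birkhoff_orthogonal:
  fixes u v :: 'a
  assumes u: "norm u = 1" and v: "norm v = 1"
  shows "birkhoff_orthogonal (u + v) (u - v)"
  unfolding birkhoff_orthogonal_def
proof (rule allI, rule ccontr)
  fix e
  assume "\<not> norm (u + v) \<le> norm (u + v + e *\<^sub>R (u - v))"
  then obtain d where d: "d > 0" "norm (u + v + e *\<^sub>R (u - v)) = norm (u + v) - d"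
    by (metis diff_diff_eq2 add_diff_cancel_left' diff_gt_0_iff_gt not_le)
  then have e: "e \<noteq> 0" by auto
  \<comment> \<open>The first bound makes the combination below convex, the second keeps
    \<open>1 + h\<close> at least 1/2, and the third holds the quadratic error to half of the linear
    gain \<open>s * d\<close>.\<close>
  define s where "s = min (min 1 (1 / (2 * \<bar>e\<bar>))) (d / (4 * e\<^sup>2))"
  define h where "h = s * e"
  have s: "0 < s" "s \<le> 1" "s \<le> 1 / (2 * \<bar>e\<bar>)" "s \<le> d / (4 * e\<^sup>2)"
    using d e by (auto simp: s_def)
  have "\<bar>h\<bar> = s * \<bar>e\<bar>" using s by (simp add: h_def abs_mult)
  then have h: "\<bar>h\<bar> \<le> 1/2" using s e by (simp add: field_simps)
  have "h\<^sup>2 / (1 + h) \<le> h\<^sup>2 / (1/2)"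
    using h by (intro divide_left_mono) auto
  also have "\<dots> = s * (2 * (s * e\<^sup>2))" by (simp add: h_def power2_eq_square)
  also have "\<dots> \<le> s * (d / 2)"
    using s e by (intro mult_left_mono) (auto simp: field_simps)
  also have "\<dots> < s * d" using s d by simp
  finally have small: "h\<^sup>2 / (1 + h) < s * d" .
  have coef: "inverse (1 + h) = 1 - h + h\<^sup>2 / (1 + h)"
    using h by (simp add: field_simps power2_eq_square)
  have "norm (u + v) \<le> norm ((1 + h) *\<^sub>R u + v /\<^sub>R (1 + h))"
    using h by (intro lorch u v) auto
  also have "(1 + h) *\<^sub>R u + v /\<^sub>R (1 + h)
      = ((1 - s) *\<^sub>R (u + v) + s *\<^sub>R (u + v + e *\<^sub>R (u - v))) + (h\<^sup>2 / (1 + h)) *\<^sub>R v"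
    unfolding coef by (simp add: algebra_simps h_def)
  also have "norm \<dots> \<le> norm ((1 - s) *\<^sub>R (u + v)) + norm (s *\<^sub>R (u + v + e *\<^sub>R (u - v)))
      + norm ((h\<^sup>2 / (1 + h)) *\<^sub>R v)"
    by (meson add_right_mono norm_triangle_ineq order_trans)
  also have "\<dots> = (1 - s) * norm (u + v) + s * (norm (u + v) - d) + h\<^sup>2 / (1 + h)"
    using s h v d by simp
  also have "\<dots> < norm (u + v)"
    using small by (simp add: algebra_simps)
  finally show False by simp
qed

text \<open>Divided by their common norm, \<open>x + y\<close> and \<open>x - y\<close> become unit
  vectors whose sum and difference are the same positive multiple of \<open>x\<close> and of
  \<open>y\<close>.\<close>

lemma isosceles_imp_birkhoff:
  fixes x y :: 'a
  assumes "norm (x + y) = norm (x - y)"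
  shows "birkhoff_orthogonal x y"
proof (cases "norm (x + y) = 0")
  case True
  with assms have "x + y = 0" "x - y = 0" by auto
  then have "(x + y) + (x - y) = 0" by simp
  then have "x = 0" by (simp flip: scaleR_2)
  then show ?thesis by (simp add: birkhoff_orthogonal_def)
next
  case False
  define n where "n = norm (x + y)"
  have n: "n > 0" using False by (simp add: n_def)
  have "birkhoff_orthogonal ((x + y) /\<^sub>R n + (x - y) /\<^sub>R n) ((x + y) /\<^sub>R n - (x - y) /\<^sub>R n)"
    by (rule unit_birkhoff_orthogonal) (use n assms in \<open>auto simp: n_def\<close>)
  moreover have "(x + y) /\<^sub>R n + (x - y) /\<^sub>R n = (2 / n) *\<^sub>R x"
    by (simp add: algebra_simps divide_inverse flip: scaleR_2)
  moreover have "(x + y) /\<^sub>R n - (x - y) /\<^sub>R n = (2 / n) *\<^sub>R y"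
    by (simp add: algebra_simps divide_inverse flip: scaleR_2)
  ultimately have b: "norm ((2 / n) *\<^sub>R x) \<le> norm ((2 / n) *\<^sub>R x + t *\<^sub>R (2 / n) *\<^sub>R y)" for t
    by (simp add: birkhoff_orthogonal_def)
  have "norm x \<le> norm (x + t *\<^sub>R y)" for t
  proof -
    have "(2 / n) *\<^sub>R x + t *\<^sub>R (2 / n) *\<^sub>R y = (2 / n) *\<^sub>R (x + t *\<^sub>R y)"
      by (simp add: algebra_simps)
    then show ?thesis
      using b[of t] n by (simp add: divide_le_cancel mult_le_cancel_left)
  qed
  then show ?thesis by (simp add: birkhoff_orthogonal_def)
qed

text \<open>Follow a flat piece of the unit sphere from \<open>u\<close> beyond its end: the unit vector \<open>q\<close> lies off
  the flat piece, whereas \<open>q + u\<close> points into its interior, so that the norm decreases along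
  \<open>q - u\<close>.\<close>

lemma strictly_convex:
  fixes u v :: 'a
  assumes u: "norm u = 1" and v: "norm v = 1" and uv: "norm (u + v) = 2"
  shows "u = v"
proof (rule ccontr)
  assume ne: "u \<noteq> v"
  \<comment> \<open>Points on the ray from \<open>u\<close> through \<open>v = p 0\<close>, with
    distances from \<open>u\<close> that double. They eventually leave the unit ball, and
    \<open>p n\<close> is the midpoint of \<open>u\<close> and \<open>p (Suc n)\<close>.\<close>
  define p where "p n = u + (2 ^ n) *\<^sub>R (v - u)" for n :: nat
  have p_Suc: "p (Suc n) = 2 *\<^sub>R p n - u" for n
    by (simp add: p_def algebra_simps scaleR_2)
  have "\<exists>n. \<not> norm (p n) \<le> 1"
  proof (rule ccontr)
    assume "\<nexists>n. \<not> norm (p n) \<le> 1"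
    then have le: "norm (p n) \<le> 1" for n by blast
    obtain n where n: "2 / norm (v - u) < 2 ^ n"
      using real_arch_pow[of 2 "2 / norm (v - u)"] by auto
    have "2 ^ n * norm (v - u) = norm (p n - u)" by (simp add: p_def)
    also have "\<dots> \<le> norm (p n) + norm u" by (rule norm_triangle_ineq4)
    also have "\<dots> \<le> 2" using le[of n] u by simp
    finally show False using n ne by (simp add: field_simps)
  qed
  moreover have "norm (p 0) \<le> 1" using v by (simp add: p_def)
  ultimately obtain n where n: "norm (p n) \<le> 1" "1 < norm (p (Suc n))"
    using nat_induct[of "\<lambda>n. norm (p n) \<le> 1"] by (meson not_le)
  \<comment> \<open>The midpoint of \<open>u\<close> and \<open>v\<close> has norm 1 and lies on the
    segment from \<open>u\<close> to \<open>p n\<close> at parameter \<open>1 / 2 ^ Suc n\<close>,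
    strictly inside even for \<open>n = 0\<close>.\<close>
  have add: "norm (a *\<^sub>R u + b *\<^sub>R p n) = a + b" if "0 \<le> a" "0 \<le> b" for a b
  proof (rule norm_cone_eq_sum[OF _ _ _ _ _ that])
    show "norm u \<le> 1" "norm (p n) \<le> 1" using u n by auto
    show "(0::real) < 1 / 2 ^ Suc n" by simp
    show "(1::real) / 2 ^ Suc n < 1" by (simp del: power_Suc)
    have "(1 - 1 / 2 ^ Suc n) *\<^sub>R u + (1 / 2 ^ Suc n) *\<^sub>R p n = (1/2) *\<^sub>R (u + v)"
    proof -
      have "(1/2) *\<^sub>R (v - u) = (1/2) *\<^sub>R (u + v) - u"
        using scaleR_half_double[of u] by (simp add: algebra_simps)
      then show ?thesis by (simp add: p_def algebra_simps)
    qed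
    then show "1 \<le> norm ((1 - 1 / 2 ^ Suc n) *\<^sub>R u + (1 / 2 ^ Suc n) *\<^sub>R p n)"
      using uv by simp
  qed
  define N where "N = norm (p (Suc n))"
  define q where "q = p (Suc n) /\<^sub>R N"
  have N: "1 < N" using n by (simp add: N_def)
  \<comment> \<open>The farthest move along \<open>q - u\<close> that keeps \<open>q + u\<close> in
    the cone of \<open>u\<close> and \<open>p n\<close>, where the norm is the sum of the
    coefficients: here the coefficient of \<open>u\<close> becomes 0.\<close>
  define t where "t = (1 - 1/N) / (1 + 1/N)"
  have "1 + 1/N > 0" using N by (simp add: add_pos_pos)
  then have t: "0 < t" "t * (1 + 1/N) = 1 - 1/N"
    using N by (simp_all add: t_def)
  have "norm q = 1"
    using N unfolding q_def norm_scaleR N_def[symmetric] by simp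
  then have "birkhoff_orthogonal (q + u) (q - u)" by (rule unit_birkhoff_orthogonal[OF _ u])
  then have "norm (q + u) \<le> norm (q + u + t *\<^sub>R (q - u))" by (simp add: birkhoff_orthogonal_def)
  also have "q + u + t *\<^sub>R (q - u) = (1 - 1/N - t * (1 + 1/N)) *\<^sub>R u + ((1 + t) * (2/N)) *\<^sub>R p n"
    by (simp add: q_def p_Suc algebra_simps divide_inverse)
  also have "norm \<dots> = (1 - 1/N - t * (1 + 1/N)) + (1 + t) * (2/N)"
    using t N by (intro add) auto
  also have "\<dots> = 1 + 1/N - t * (1 - 1/N)" by (simp add: algebra_simps add_divide_distrib)
  also have "\<dots> < 1 + 1/N" using t N by simp
  also have "1 + 1/N = norm ((1 - 1/N) *\<^sub>R u + (2/N) *\<^sub>R p n)"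
    using N by (subst add) auto
  also have "(1 - 1/N) *\<^sub>R u + (2/N) *\<^sub>R p n = q + u"
    by (simp add: q_def p_Suc algebra_simps divide_inverse)
  finally show False by simp
qed

section \<open>Uniqueness of the orthogonal direction, and isometric reflections\<close>

text \<open>Both \<open>a x\<close> and \<open>a x + b y\<close> minimize the norm on the same line
  parallel to \<open>y\<close>. Their midpoint cannot have smaller norm, so strict convexity makes
  them coincide.\<close>

lemma birkhoff_left_unique:
  fixes x y :: 'a
  assumes x: "birkhoff_orthogonal x y" and z: "birkhoff_orthogonal (a *\<^sub>R x + b *\<^sub>R y) y"
  shows "b *\<^sub>R y = 0"
proof -
  define c where "c = norm (a *\<^sub>R x)"
  have ge: "c \<le> norm (a *\<^sub>R x + t *\<^sub>R y)" for t
  proof (cases "a = 0")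
    case False
    have "norm x \<le> norm (x + (t / a) *\<^sub>R y)" using x by (simp add: birkhoff_orthogonal_def)
    then have "\<bar>a\<bar> * norm x \<le> norm (a *\<^sub>R (x + (t / a) *\<^sub>R y))"
      by (simp add: mult_left_mono)
    then show ?thesis using False by (simp add: algebra_simps c_def)
  qed (simp add: c_def)
  have "norm (a *\<^sub>R x + b *\<^sub>R y) \<le> norm (a *\<^sub>R x + b *\<^sub>R y + (- b) *\<^sub>R y)"
    using z unfolding birkhoff_orthogonal_def by blast
  then have eq: "norm (a *\<^sub>R x + b *\<^sub>R y) = c"
    using ge[of b] by (simp add: c_def)
  show ?thesis
  proof (cases "c = 0")
    case True
    then show ?thesis using eq by (auto simp: c_def)
  next
    case False
    then have c: "c > 0" by (simp add: c_def)
    have sum: "a *\<^sub>R x + (a *\<^sub>R x + b *\<^sub>R y) = 2 *\<^sub>R (a *\<^sub>R x + (b / 2) *\<^sub>R y)"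
      by (simp add: scaleR_add_right scaleR_2 flip: scaleR_add_left)
    have "norm (a *\<^sub>R x + (a *\<^sub>R x + b *\<^sub>R y)) = 2 * c"
    proof (rule antisym)
      show "norm (a *\<^sub>R x + (a *\<^sub>R x + b *\<^sub>R y)) \<le> 2 * c"
        using norm_triangle_ineq[of "a *\<^sub>R x" "a *\<^sub>R x + b *\<^sub>R y"] eq by (simp add: c_def)
      show "2 * c \<le> norm (a *\<^sub>R x + (a *\<^sub>R x + b *\<^sub>R y))"
        unfolding sum using ge[of "b / 2"] by simp
    qed
    then have "norm ((a *\<^sub>R x) /\<^sub>R c + (a *\<^sub>R x + b *\<^sub>R y) /\<^sub>R c) = 2"
      using c by (simp del: scaleR_scaleR flip: scaleR_add_right)
    moreover have "norm ((a *\<^sub>R x) /\<^sub>R c) = 1"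
      using c unfolding norm_scaleR[of "inverse c"] c_def[symmetric] by simp
    moreover have "norm ((a *\<^sub>R x + b *\<^sub>R y) /\<^sub>R c) = 1" using c eq by simp
    ultimately have "(a *\<^sub>R x) /\<^sub>R c = (a *\<^sub>R x + b *\<^sub>R y) /\<^sub>R c"
      by (intro strictly_convex)
    then have "a *\<^sub>R x = a *\<^sub>R x + b *\<^sub>R y"
      using c unfolding scaleR_cancel_left by simp
    then show ?thesis by simp
  qed
qed

text \<open>The chord from \<open>a x + b y\<close> in direction \<open>y\<close> ends at a second
  point of equal norm. Its midpoint is orthogonal to \<open>y\<close>, hence equals
  \<open>a x\<close> by uniqueness, and so the second end is \<open>a x - b y\<close>.\<close>

lemma isosceles_scale:
  fixes x y :: 'a
  assumes xy: "norm (x + y) = norm (x - y)"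
  shows "norm (a *\<^sub>R x + b *\<^sub>R y) = norm (a *\<^sub>R x - b *\<^sub>R y)"
proof -
  have bx: "birkhoff_orthogonal x y" by (rule isosceles_imp_birkhoff[OF xy])
  have pos: "norm (a *\<^sub>R x + b *\<^sub>R y) = norm (a *\<^sub>R x - b *\<^sub>R y)" if b: "b > 0" for b
  proof (cases "y = 0")
    case False
    define g where "g t = norm (a *\<^sub>R x + b *\<^sub>R y - t *\<^sub>R y)" for t
    have gb: "g b \<le> g 0"
    proof (cases "a = 0")
      case False
      have "norm x \<le> norm (x + (b / a) *\<^sub>R y)" using bx by (simp add: birkhoff_orthogonal_def)
      then have "\<bar>a\<bar> * norm x \<le> norm (a *\<^sub>R (x + (b / a) *\<^sub>R y))"
        by (simp add: mult_left_mono)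
      then show ?thesis using False by (simp add: algebra_simps g_def)
    qed (simp add: g_def)
    \<comment> \<open>By the triangle inequality \<open>g T\<close> is at least \<open>g 0\<close>.
      Since the interval starts at \<open>b > 0\<close>, the intermediate value theorem cannot
      return the trivial solution \<open>s = 0\<close>.\<close>
    define T where "T = b + 2 * g 0 / norm y"
    have T: "b \<le> T" by (simp add: T_def g_def)
    have "T * norm y = norm ((a *\<^sub>R x + b *\<^sub>R y) - (a *\<^sub>R x + b *\<^sub>R y - T *\<^sub>R y))"
      using T b by simp
    also have "\<dots> \<le> g 0 + g T"
      unfolding g_def by (intro order_trans[OF norm_triangle_ineq4]) simp
    finally have gT: "g 0 \<le> g T"
      using False b by (simp add: T_def algebra_simps)
         (smt (verit) mult_nonneg_nonneg norm_ge_zero)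
    have "continuous_on {b..T} g"
      unfolding g_def by (intro continuous_intros)
    then obtain s where s: "b \<le> s" "g s = g 0"
      using IVT'[of g b "g 0" T] gb gT T by blast
    define p where "p = a *\<^sub>R x + b *\<^sub>R y"
    have "norm (p - (s/2) *\<^sub>R y + (s/2) *\<^sub>R y) = norm (p - (s/2) *\<^sub>R y - (s/2) *\<^sub>R y)"
      using s(2) by (simp add: g_def p_def diff_diff_eq flip: scaleR_add_left)
    then have "birkhoff_orthogonal (p - (s/2) *\<^sub>R y) ((s/2) *\<^sub>R y)"
      by (rule isosceles_imp_birkhoff)
    then have le: "norm (p - (s/2) *\<^sub>R y) \<le> norm (p - (s/2) *\<^sub>R y + t *\<^sub>R (s/2) *\<^sub>R y)" for t
      unfolding birkhoff_orthogonal_def by blast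
    have "birkhoff_orthogonal (a *\<^sub>R x + (b - s/2) *\<^sub>R y) y"
      unfolding birkhoff_orthogonal_def
    proof
      fix t
      show "norm (a *\<^sub>R x + (b - s/2) *\<^sub>R y) \<le> norm (a *\<^sub>R x + (b - s/2) *\<^sub>R y + t *\<^sub>R y)"
        using le[of "t / (s/2)"] s b by (simp add: p_def algebra_simps)
    qed
    from birkhoff_left_unique[OF bx this] have "s = 2 * b" using False by simp
    then show ?thesis using s(2) by (simp add: g_def algebra_simps scaleR_2 flip: scaleR_scaleR)
  qed simp
  consider "b > 0" | "b = 0" | "- b > 0" by linarith
  then show ?thesis
  proof cases
    case 3
    then show ?thesis using pos[of "- b"] by simp
  qed (simp_all add: pos)
qed

text \<open>The sum and the difference of \<open>u + v\<close> and \<open>u - v\<close> are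
  \<open>2 u\<close> and \<open>2 v\<close>, of equal norm. Exchanging \<open>u\<close> and
  \<open>v\<close> changes only the sign of the \<open>u - v\<close> component.\<close>

lemma ficken:
  fixes u v :: 'a
  assumes "norm u = norm v"
  shows "norm (a *\<^sub>R u + b *\<^sub>R v) = norm (b *\<^sub>R u + a *\<^sub>R v)"
proof -
  have "norm ((u + v) + (u - v)) = norm ((u + v) - (u - v))"
    using assms by (simp flip: scaleR_2)
  from isosceles_scale[OF this, of "(a + b) / 2" "(a - b) / 2"]
  have "norm (((a + b) / 2) *\<^sub>R (u + v) + ((a - b) / 2) *\<^sub>R (u - v)) =
    norm (((a + b) / 2) *\<^sub>R (u + v) - ((a - b) / 2) *\<^sub>R (u - v))" .
  moreover have "((a + b) / 2) *\<^sub>R (u + v) + ((a - b) / 2) *\<^sub>R (u - v) = a *\<^sub>R u + b *\<^sub>R v"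
  proof -
    have "((a + b) / 2) *\<^sub>R (u + v) + ((a - b) / 2) *\<^sub>R (u - v) =
        ((a + b) / 2 + (a - b) / 2) *\<^sub>R u + ((a + b) / 2 - (a - b) / 2) *\<^sub>R v"
      by (simp only: scaleR_add_left scaleR_diff_left scaleR_add_right scaleR_diff_right) simp
    then show ?thesis by (simp add: field_simps)
  qed
  moreover have "((a + b) / 2) *\<^sub>R (u + v) - ((a - b) / 2) *\<^sub>R (u - v) = b *\<^sub>R u + a *\<^sub>R v"
  proof -
    have "((a + b) / 2) *\<^sub>R (u + v) - ((a - b) / 2) *\<^sub>R (u - v) =
        ((a + b) / 2 - (a - b) / 2) *\<^sub>R u + ((a + b) / 2 + (a - b) / 2) *\<^sub>R v"
      by (simp only: scaleR_add_left scaleR_diff_left scaleR_add_right scaleR_diff_right) simp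
    then show ?thesis by (simp add: field_simps)
  qed
  ultimately show ?thesis by simp
qed

section \<open>Euclidean planes\<close>

text \<open>Two vectors orthogonal to the unit vector \<open>W\<close> are compared: its quarter
  turn \<open>W'\<close>, and the image \<open>F\<close> of \<open>f\<close> under the reflection
  exchanging \<open>e\<close> and \<open>W\<close>. They differ by a multiple of \<open>e\<close>,
  which uniqueness forces to vanish.\<close>

lemma orthonormal_unit:
  fixes e f :: 'a
  assumes e: "norm e = 1" and f: "norm f = 1" and ef: "norm (e + f) = norm (e - f)"
    and w: "norm (a *\<^sub>R e + b *\<^sub>R f) = 1"
  shows "a\<^sup>2 + b\<^sup>2 = 1"
proof (cases "a = 0 \<or> b = 0")
  case True
  then show ?thesis using w e f by (auto simp: abs_square_eq_1)
next
  case False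
  then have a: "a \<noteq> 0" and b: "b \<noteq> 0" by auto
  have D: "a\<^sup>2 + b\<^sup>2 \<noteq> 0" using a by simp
  define W where "W = a *\<^sub>R e + b *\<^sub>R f"
  define W' where "W' = b *\<^sub>R e - a *\<^sub>R f"
  \<comment> \<open>Solve \<open>W = a e + b f\<close> for \<open>f\<close> and exchange
    \<open>e\<close> and \<open>W\<close>.\<close>
  define F where "F = (1 / b) *\<^sub>R e - (a / b) *\<^sub>R W"
  have F_eq: "F = ((1 - a\<^sup>2) / b) *\<^sub>R e - a *\<^sub>R f"
    using b by (simp add: F_def W_def algebra_simps diff_divide_distrib power2_eq_square)
  have "norm (W' + W) = norm ((a + b) *\<^sub>R e + (b - a) *\<^sub>R f)"
    by (simp add: W_def W'_def algebra_simps)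
  also have "\<dots> = norm ((b - a) *\<^sub>R e + (a + b) *\<^sub>R f)"
    by (rule ficken) (simp add: e f)
  also have "\<dots> = norm ((b - a) *\<^sub>R e - (a + b) *\<^sub>R f)"
    by (rule isosceles_scale[OF ef])
  also have "\<dots> = norm (W' - W)"
    by (simp add: W_def W'_def algebra_simps)
  finally have W'W: "birkhoff_orthogonal W' W" by (rule isosceles_imp_birkhoff)
  have "norm (F + W) = norm ((1 / b) *\<^sub>R e + (1 - a / b) *\<^sub>R W)"
    by (simp add: F_def algebra_simps)
  also have "\<dots> = norm ((1 - a / b) *\<^sub>R e + (1 / b) *\<^sub>R W)"
    by (rule ficken) (simp add: e w W_def)
  also have "(1 - a / b) *\<^sub>R e + (1 / b) *\<^sub>R W = e + f"
    using b by (simp add: W_def algebra_simps)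
  also have "norm (e + f) = norm (e - f)" by (rule ef)
  also have "e - f = (1 + a / b) *\<^sub>R e + (- (1 / b)) *\<^sub>R W"
    using b by (simp add: W_def algebra_simps)
  also have "norm \<dots> = norm ((- (1 / b)) *\<^sub>R e + (1 + a / b) *\<^sub>R W)"
    by (rule ficken) (simp add: e w W_def)
  also have "\<dots> = norm (F - W)"
    by (subst norm_minus_cancel[symmetric]) (simp add: F_def algebra_simps)
  finally have FW: "birkhoff_orthogonal F W" by (rule isosceles_imp_birkhoff)
  \<comment> \<open>\<open>F = W' + k e\<close>, and \<open>k = 0\<close> is exactly the
    claim.\<close>
  define k where "k = (1 - a\<^sup>2) / b - b"
  have e_eq: "e = (b / (a\<^sup>2 + b\<^sup>2)) *\<^sub>R W' + (a / (a\<^sup>2 + b\<^sup>2)) *\<^sub>R W"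
  proof -
    have "(b / (a\<^sup>2 + b\<^sup>2)) *\<^sub>R W' + (a / (a\<^sup>2 + b\<^sup>2)) *\<^sub>R W =
        (b / (a\<^sup>2 + b\<^sup>2) * b + a / (a\<^sup>2 + b\<^sup>2) * a) *\<^sub>R e
        + (a / (a\<^sup>2 + b\<^sup>2) * b - b / (a\<^sup>2 + b\<^sup>2) * a) *\<^sub>R f"
      by (simp add: W_def W'_def algebra_simps)
    also have "b / (a\<^sup>2 + b\<^sup>2) * b + a / (a\<^sup>2 + b\<^sup>2) * a = 1"
      using D by (simp add: power2_eq_square add.commute flip: add_divide_distrib)
    finally show ?thesis by (simp add: mult.commute)
  qed
  have "F = W' + k *\<^sub>R e"
    by (simp add: F_eq W'_def k_def algebra_simps)
  also have "\<dots> = W' + k *\<^sub>R ((b / (a\<^sup>2 + b\<^sup>2)) *\<^sub>R W' + (a / (a\<^sup>2 + b\<^sup>2)) *\<^sub>R W)"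
    by (subst e_eq) simp
  also have "\<dots> = (1 + k * (b / (a\<^sup>2 + b\<^sup>2))) *\<^sub>R W' + (k * (a / (a\<^sup>2 + b\<^sup>2))) *\<^sub>R W"
    by (simp add: algebra_simps)
  finally have "birkhoff_orthogonal
      ((1 + k * (b / (a\<^sup>2 + b\<^sup>2))) *\<^sub>R W' + (k * (a / (a\<^sup>2 + b\<^sup>2))) *\<^sub>R W) W"
    using FW by simp
  from birkhoff_left_unique[OF W'W this] have "(k * (a / (a\<^sup>2 + b\<^sup>2))) *\<^sub>R W = 0" .
  moreover have "W \<noteq> 0" using w by (auto simp: W_def)
  ultimately have "k = 0" using a D by simp
  then show ?thesis using b by (simp add: k_def field_simps power2_eq_square)
qed

lemma orthonormal_norm:
  fixes e f :: 'a
  assumes "norm e = 1" "norm f = 1" "norm (e + f) = norm (e - f)"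
  shows "(norm (a *\<^sub>R e + b *\<^sub>R f))\<^sup>2 = a\<^sup>2 + b\<^sup>2"
proof (cases "norm (a *\<^sub>R e + b *\<^sub>R f) = 0")
  \<comment> \<open>The norms of \<open>a e + b f\<close> and \<open>a e - b f\<close> agree, so
    both vectors vanish here.\<close>
  case True
  then have "a *\<^sub>R e + b *\<^sub>R f = 0" "a *\<^sub>R e - b *\<^sub>R f = 0"
    using isosceles_scale[OF assms(3), of a b] by auto
  moreover from this have "2 *\<^sub>R (b *\<^sub>R f) = 0" unfolding scaleR_2 by simp
  ultimately have "a *\<^sub>R e = 0" "b *\<^sub>R f = 0" by auto
  then show ?thesis using assms True by auto
next
  case False
  define n where "n = norm (a *\<^sub>R e + b *\<^sub>R f)"
  have n: "n > 0" using False by (simp add: n_def)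
  have "(a / n) *\<^sub>R e + (b / n) *\<^sub>R f = (a *\<^sub>R e + b *\<^sub>R f) /\<^sub>R n"
    by (simp add: algebra_simps divide_inverse)
  then have "norm ((a / n) *\<^sub>R e + (b / n) *\<^sub>R f) = 1"
    using n by (simp add: n_def)
  from orthonormal_unit[OF assms this] have "(a / n)\<^sup>2 + (b / n)\<^sup>2 = 1" .
  then show ?thesis unfolding n_def[symmetric] using n by (simp add: field_simps)
qed

text \<open>The diagonals \<open>u + v\<close> and \<open>u - v\<close> of the rhombus on the
  normalized vectors yield an orthonormal basis of their plane. The parallelogram law and the
  homogeneity of the inner product then follow by evaluation at a few coefficients.\<close>

lemma norm_quadratic_form:
  fixes x y :: 'a
  obtains A B C where
    "\<And>a b. (norm (a *\<^sub>R x + b *\<^sub>R y))\<^sup>2 = A * a\<^sup>2 + 2 * B * a * b + C * b\<^sup>2"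
proof -
  define u where "u = x /\<^sub>R norm x"
  define v where "v = y /\<^sub>R norm y"
  have x: "x = norm x *\<^sub>R u" and y: "y = norm y *\<^sub>R v"
    by (cases "x = 0"; cases "y = 0"; simp add: u_def v_def)+
  note witness = that
  \<comment> \<open>Linearly dependent \<open>x\<close> and \<open>y\<close>, where a diagonal may
    vanish.\<close>
  have dep: ?thesis if "x = p *\<^sub>R z" "y = q *\<^sub>R z" for p q :: real and z
  proof (rule witness)
    fix a b
    have "a *\<^sub>R x + b *\<^sub>R y = (a * p + b * q) *\<^sub>R z" using that by (simp add: algebra_simps)
    then show "(norm (a *\<^sub>R x + b *\<^sub>R y))\<^sup>2 = ((norm z)\<^sup>2 * p\<^sup>2) * a\<^sup>2
        + 2 * ((norm z)\<^sup>2 * p * q) * a * b + ((norm z)\<^sup>2 * q\<^sup>2) * b\<^sup>2"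
      by (simp add: power_mult_distrib) (simp add: power2_eq_square algebra_simps)
  qed
  consider "x = 0" | "y = 0" | "u = v" | "u = - v"
    | "x \<noteq> 0" "y \<noteq> 0" "u + v \<noteq> 0" "u - v \<noteq> 0"
    by (metis eq_iff_diff_eq_0 eq_neg_iff_add_eq_0)
  then show ?thesis
  proof cases
    case 1
    then show ?thesis using dep[of 0 y 1] by simp
  next
    case 2
    then show ?thesis using dep[of 1 x 0] by simp
  next
    case 3
    then show ?thesis using dep[of "norm x" v "norm y"] x y by simp
  next
    case 4
    then show ?thesis using dep[of "- norm x" v "norm y"] x y by simp
  next
    case 5
    define m where "m = norm (u + v)"
    define n where "n = norm (u - v)"
    define e where "e = (u + v) /\<^sub>R m"
    define f where "f = (u - v) /\<^sub>R n"
    have mn: "m > 0" "n > 0" using 5 by (auto simp: m_def n_def)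
    have uv: "norm u = 1" "norm v = 1" using 5 by (auto simp: u_def v_def)
    have ef: "norm e = 1" "norm f = 1" using mn by (auto simp: e_def f_def m_def n_def)
    have "norm ((u + v) + (u - v)) = norm ((u + v) - (u - v))"
      using uv by (simp flip: scaleR_2)
    from isosceles_scale[OF this, of "inverse m" "inverse n"]
    have orth: "norm (e + f) = norm (e - f)" unfolding e_def f_def .
    have ue: "u = (m / 2) *\<^sub>R e + (n / 2) *\<^sub>R f"
      using mn by (simp add: e_def f_def) (simp add: algebra_simps flip: scaleR_2 scaleR_add_left)
    have ve: "v = (m / 2) *\<^sub>R e - (n / 2) *\<^sub>R f"
      using mn by (simp add: e_def f_def) (simp add: algebra_simps flip: scaleR_2 scaleR_add_left)
    define p q where "p = norm x" and "q = norm y"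
    show ?thesis
    proof (rule that)
      fix a b
      have "a *\<^sub>R x + b *\<^sub>R y = (a * p) *\<^sub>R u + (b * q) *\<^sub>R v"
        unfolding p_def q_def by (metis x y scaleR_scaleR)
      also have "\<dots> = ((a * p + b * q) * (m / 2)) *\<^sub>R e + ((a * p - b * q) * (n / 2)) *\<^sub>R f"
        unfolding ue ve by (simp add: algebra_simps)
      finally have "(norm (a *\<^sub>R x + b *\<^sub>R y))\<^sup>2 =
          ((a * p + b * q) * (m / 2))\<^sup>2 + ((a * p - b * q) * (n / 2))\<^sup>2"
        using orthonormal_norm[OF ef orth] by simp
      then show "(norm (a *\<^sub>R x + b *\<^sub>R y))\<^sup>2 = (p\<^sup>2 * (m\<^sup>2 + n\<^sup>2) / 4) * a\<^sup>2
          + 2 * (p * q * (m\<^sup>2 - n\<^sup>2) / 4) * a * b + (q\<^sup>2 * (m\<^sup>2 + n\<^sup>2) / 4) * b\<^sup>2"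
        by (simp add: power2_eq_square field_simps)
    qed
  qed
qed

section \<open>The inner product by polarization\<close>

lemma inner_product_space: "inner_product_space TYPE('a)"
proof -
  define ip :: "'a \<Rightarrow> 'a \<Rightarrow> real" where
    "ip x y = ((norm (x + y))\<^sup>2 - (norm (x - y))\<^sup>2) / 4" for x y
  have parallelogram:
    "(norm (x + y))\<^sup>2 + (norm (x - y))\<^sup>2 = 2 * (norm x)\<^sup>2 + 2 * (norm y)\<^sup>2" for x y :: 'a
  proof -
    obtain A B C where
      Q: "\<And>a b. (norm (a *\<^sub>R x + b *\<^sub>R y))\<^sup>2 = A * a\<^sup>2 + 2 * B * a * b + C * b\<^sup>2"
      using norm_quadratic_form[of x y] by blast
    show ?thesis using Q[of 1 1] Q[of 1 "-1"] Q[of 1 0] Q[of 0 1] by simp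
  qed
  have scale: "ip (r *\<^sub>R x) y = r * ip x y" for r x y
  proof -
    obtain A B C where
      Q: "\<And>a b. (norm (a *\<^sub>R x + b *\<^sub>R y))\<^sup>2 = A * a\<^sup>2 + 2 * B * a * b + C * b\<^sup>2"
      using norm_quadratic_form[of x y] by blast
    show ?thesis using Q[of 1 1] Q[of 1 "-1"] Q[of r 1] Q[of r "-1"] by (simp add: ip_def)
  qed
  have sym: "ip x y = ip y x" for x y
    by (simp add: ip_def norm_minus_commute add.commute)
  have self: "(norm x)\<^sup>2 = ip x x" for x
    by (simp add: ip_def power_mult_distrib flip: scaleR_2)
  have add: "ip (x + y) z = ip x z + ip y z" for x y z
  proof -
    \<comment> \<open>The two parallelogram laws share the term in \<open>x - y\<close>, which
      cancels in their difference; this produces \<open>2 z\<close> and hence the factor 2.\<close>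
    have "2 * ip (x + y) z = ip (x + y) (2 *\<^sub>R z)" using scale sym by metis
    also have "\<dots> = 2 * ip x z + 2 * ip y z"
      using parallelogram[of "x + z" "y + z"] parallelogram[of "x - z" "y - z"]
      by (simp add: ip_def algebra_simps scaleR_2 diff_divide_distrib)
    finally show ?thesis by simp
  qed
  have "is_inner_product ip"
    unfolding is_inner_product_def
    using sym add scale by (auto simp flip: self)
  with self show ?thesis unfolding inner_product_space_def by blast
qed

end

section \<open>Equivalence of the three statements\<close>

lemma angular_dist_commute: "angular_dist x y = angular_dist y x"
  by (simp add: angular_dist_def norm_minus_commute)

lemma skew_angular_dist_commute: "skew_angular_dist x y = skew_angular_dist y x"
  by (simp add: skew_angular_dist_def norm_minus_commute)

text \<open>For \<open>norm x \<le> norm y\<close>, apply the hypothesis to \<open>x\<close> and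
  \<open>- y\<close> at \<open>t = norm x / norm y\<close> and divide by \<open>norm x\<close>.
  Symmetry of both distances covers the other case.\<close>

lemma angular_le_skew_if_n_map_le:
  fixes x y :: "'a::real_normed_vector"
  assumes n: "\<And>(x::'a) y t. norm x \<le> norm y \<Longrightarrow> t \<in> {0..1} \<Longrightarrow> n_map x y t \<le> n_map y x t"
    and "x \<noteq> 0" "y \<noteq> 0"
  shows "angular_dist x y \<le> skew_angular_dist x y"
  using \<open>x \<noteq> 0\<close> \<open>y \<noteq> 0\<close>
proof (induction "norm x" "norm y" arbitrary: x y rule: linorder_wlog)
  case (le x y)
  define p q where "p = norm x" and "q = norm y"
  have pq: "0 < p" "0 < q" "p \<le> q" using le by (auto simp: p_def q_def)
  have "n_map x (- y) (p / q) \<le> n_map (- y) x (p / q)"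
    using pq by (intro n) (auto simp: p_def q_def)
  then have "norm (x - (p / q) *\<^sub>R y) / p \<le> norm ((p / q) *\<^sub>R x - y) / p"
    using pq by (simp add: n_map_def divide_right_mono)
  also have "norm (x - (p / q) *\<^sub>R y) / p = norm ((x - (p / q) *\<^sub>R y) /\<^sub>R p)"
    using pq by (simp add: divide_inverse)
  also have "(x - (p / q) *\<^sub>R y) /\<^sub>R p = x /\<^sub>R p - y /\<^sub>R q"
    using pq by (simp add: algebra_simps divide_inverse)
  also have "norm ((p / q) *\<^sub>R x - y) / p = norm (((p / q) *\<^sub>R x - y) /\<^sub>R p)"
    using pq by (simp add: divide_inverse)
  also have "((p / q) *\<^sub>R x - y) /\<^sub>R p = x /\<^sub>R q - y /\<^sub>R p"
    using pq by (simp add: algebra_simps divide_inverse)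
  finally show ?case by (simp add: angular_dist_def skew_angular_dist_def p_def q_def)
next
  case (sym x y)
  then show ?case by (metis angular_dist_commute skew_angular_dist_commute)
qed

text \<open>Substitute \<open>r u\<close> and \<open>- v\<close>: the normalization removes
  \<open>r\<close> from the angular distance only, and the sign turns differences into sums.\<close>

lemma lorch_norm_if_angular_le_skew:
  assumes "\<And>(x::'a::real_normed_vector) y. x \<noteq> 0 \<Longrightarrow> y \<noteq> 0 \<Longrightarrow>
    angular_dist x y \<le> skew_angular_dist x y"
  shows "lorch_norm TYPE('a)"
proof
  fix u v :: 'a and r :: real
  assume "norm u = 1" "norm v = 1" "0 < r"
  moreover from this have "angular_dist (r *\<^sub>R u) (- v) \<le> skew_angular_dist (r *\<^sub>R u) (- v)"
    by (intro assms) auto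
  ultimately show "norm (u + v) \<le> norm (r *\<^sub>R u + v /\<^sub>R r)"
    by (simp add: angular_dist_def skew_angular_dist_def)
qed

text \<open>The cross terms of the two squared norms agree, and the rest differs by
  \<open>(1 - t^2) (|y|^2 - |x|^2)\<close>.\<close>

lemma n_map_le_if_inner_product_space:
  fixes x y :: "'a::real_normed_vector"
  assumes "inner_product_space TYPE('a)" and xy: "norm x \<le> norm y" and t: "t \<in> {0..1}"
  shows "n_map x y t \<le> n_map y x t"
proof -
  obtain ip :: "'a \<Rightarrow> 'a \<Rightarrow> real" where ip: "is_inner_product ip"
    and norm: "\<And>x. (norm x)\<^sup>2 = ip x x"
    using assms(1) by (auto simp: inner_product_space_def)
  have sym: "ip a b = ip b a" and add: "ip (a + b) c = ip a c + ip b c"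
    and scale: "ip (r *\<^sub>R a) b = r * ip a b" for a b c r
    using ip unfolding is_inner_product_def by blast+
  have expand: "(norm (a + t *\<^sub>R b))\<^sup>2 = (norm a)\<^sup>2 + 2 * t * ip a b + t\<^sup>2 * (norm b)\<^sup>2" for a b
  proof -
    have "ip (a + t *\<^sub>R b) (a + t *\<^sub>R b) = ip a (a + t *\<^sub>R b) + t * ip b (a + t *\<^sub>R b)"
      by (simp add: add scale)
    also have "ip a (a + t *\<^sub>R b) = ip a a + t * ip a b"
      by (subst sym) (simp add: add scale sym[of b a])
    also have "ip b (a + t *\<^sub>R b) = ip a b + t * ip b b"
      by (subst sym) (simp add: add scale)
    finally show ?thesis unfolding norm by (simp add: power2_eq_square algebra_simps)
  qed
  have "t\<^sup>2 \<le> 1" using t by (simp add: power_le_one)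
  moreover have "(norm x)\<^sup>2 \<le> (norm y)\<^sup>2" using xy by (simp add: power_mono)
  ultimately have "0 \<le> (1 - t\<^sup>2) * ((norm y)\<^sup>2 - (norm x)\<^sup>2)" by simp
  then have "(norm (x + t *\<^sub>R y))\<^sup>2 \<le> (norm (y + t *\<^sub>R x))\<^sup>2"
    unfolding expand by (simp add: sym[of y x] algebra_simps)
  then show ?thesis unfolding n_map_def by (rule power2_le_imp_le) simp
qed

theorem theorem2p5:
  shows "((\<forall>(x::'a::real_normed_vector) y. norm x \<le> norm y \<longrightarrow>
             (\<forall>t\<in>{0..1}. n_map x y t \<le> n_map y x t))
          \<longleftrightarrow>
          (\<forall>(x::'a) y. x \<noteq> 0 \<longrightarrow> y \<noteq> 0 \<longrightarrow> angular_dist x y \<le> skew_angular_dist x y))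
       \<and>
         ((\<forall>(x::'a) y. x \<noteq> 0 \<longrightarrow> y \<noteq> 0 \<longrightarrow> angular_dist x y \<le> skew_angular_dist x y)
          \<longleftrightarrow>
          inner_product_space TYPE('a))"
  using angular_le_skew_if_n_map_le n_map_le_if_inner_product_space
    lorch_norm.inner_product_space[OF lorch_norm_if_angular_le_skew]
  by (smt (verit))

end
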